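(* Let $\alpha$ be a rational angle. Assume that $\cos\alpha$ is a rational number. Then $$\cos\alpha \in \left\{-1, -\tfrac12, 0, \tfrac12, 1\right\}.$$
   Context: A rational angle is an angle of the form $\alpha = \frac{m}{n}\cdot 360^\circ$ with $m,n\in\mathbb{Z}$, $n\neq 0$; equivalently, in radians, $\alpha = 2\pi \frac{m}{n}$. *)

theory Defs
  imports Complex_Main
begin

text \<open>Angles are measured in radians, so that a full turn of 360 degrees is \<open>2 * pi\<close>.\<close>

definition rational_angle :: "real \<Rightarrow> bool" where
  "rational_angle \<alpha> \<longleftrightarrow> (\<exists>m n :: int. n \<noteq> 0 \<and> \<alpha> = 2 * pi * (of_int m / of_int n))"

end

theory Submission
  imports Defs
begin

text \<open>
  Write \<open>2 * cos \<alpha> = p / q\<close> in lowest terms. The addition formula makes \<open>2 * cos (k * \<alpha>)\<close> a monic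
  integer polynomial of degree \<open>k\<close> in \<open>2 * cos \<alpha>\<close>, so after clearing denominators
  \<open>q ^ k * (2 * cos (k * \<alpha>))\<close> is an integer congruent to \<open>p ^ k\<close> modulo \<open>q\<close>
  (\<open>scaled_cos_multiple_cong\<close>). Since \<open>\<alpha>\<close> is a rational angle, \<open>cos (k * \<alpha>) = 1\<close> for some
  \<open>k > 0\<close>, and then that integer is \<open>2 * q ^ k\<close>, a multiple of \<open>q\<close>. Hence \<open>q\<close> divides \<open>p ^ k\<close>; being
  coprime to \<open>p\<close>, it is \<open>1\<close>. So \<open>2 * cos \<alpha>\<close> is an integer between \<open>-2\<close> and \<open>2\<close>.
\<close>

lemma cos_multiple_recurrence:
  fixes \<alpha> :: real
  shows "cos (real (Suc (Suc k)) * \<alpha>) = 2 * cos \<alpha> * cos (real (Suc k) * \<alpha>) - cos (real k * \<alpha>)"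
proof -
  define \<beta> where "\<beta> = real (Suc k) * \<alpha>"
  have "real (Suc (Suc k)) * \<alpha> = \<beta> + \<alpha>" "real k * \<alpha> = \<beta> - \<alpha>"
    by (simp_all add: \<beta>_def algebra_simps)
  then show ?thesis
    unfolding \<beta>_def[symmetric] by (simp add: cos_add cos_diff)
qed

text \<open>
  The integers \<open>u k = q ^ k * (2 * cos (k * \<alpha>))\<close> satisfy \<open>u (k + 2) = p * u (k + 1) - q\<^sup>2 * u k\<close>,
  whose last term vanishes modulo \<open>q\<close>. The exponent starts at \<open>1\<close> because \<open>u 0 = 2\<close>, which need not
  be congruent to \<open>p ^ 0\<close>.
\<close>

lemma scaled_cos_multiple_cong:
  fixes \<alpha> :: real and p q :: int
  assumes pq: "of_int q * (2 * cos \<alpha>) = of_int p"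
  shows "\<exists>u. of_int q ^ Suc k * (2 * cos (real (Suc k) * \<alpha>)) = of_int u \<and> q dvd u - p ^ Suc k"
proof (induction k rule: induct_nat_012)
  case 0
  show ?case
    using pq by (intro exI[of _ p]) simp
next
  case 1
  have "of_int q ^ 2 * (2 * cos (2 * \<alpha>)) = (of_int q * (2 * cos \<alpha>)) ^ 2 - 2 * of_int q ^ 2"
    unfolding cos_double_cos by (simp add: algebra_simps power2_eq_square)
  also have "\<dots> = of_int (p ^ 2 - 2 * q ^ 2)"
    by (simp add: pq)
  finally show ?case
    by (intro exI[of _ "p ^ 2 - 2 * q ^ 2"]) (simp add: numeral_2_eq_2)
next
  case (ge2 k)
  then obtain u v where
    u: "of_int q ^ Suc k * (2 * cos (real (Suc k) * \<alpha>)) = of_int u" and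
    v: "of_int q ^ Suc (Suc k) * (2 * cos (real (Suc (Suc k)) * \<alpha>)) = of_int v"
       "q dvd v - p ^ Suc (Suc k)"
    by blast
  have "of_int q ^ Suc (Suc (Suc k)) * (2 * cos (real (Suc (Suc (Suc k))) * \<alpha>)) =
          (of_int q * (2 * cos \<alpha>)) * (of_int q ^ Suc (Suc k) * (2 * cos (real (Suc (Suc k)) * \<alpha>)))
          - of_int q ^ 2 * (of_int q ^ Suc k * (2 * cos (real (Suc k) * \<alpha>)))"
    unfolding cos_multiple_recurrence[of "Suc k"] by (simp add: algebra_simps power2_eq_square)
  also have "\<dots> = of_int (p * v - q ^ 2 * u)"
    unfolding u v pq by simp
  finally have eq: "of_int q ^ Suc (Suc (Suc k)) * (2 * cos (real (Suc (Suc (Suc k))) * \<alpha>)) =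
    of_int (p * v - q ^ 2 * u)" .
  have "p * v - q ^ 2 * u - p ^ Suc (Suc (Suc k)) = p * (v - p ^ Suc (Suc k)) - q * (q * u)"
    by (simp add: algebra_simps power2_eq_square)
  with v(2) have "q dvd p * v - q ^ 2 * u - p ^ Suc (Suc (Suc k))"
    by simp
  with eq show ?case
    by blast
qed

lemma rational_angle_cos_multiple_eq_1:
  assumes "rational_angle \<alpha>"
  obtains k where "cos (real (Suc k) * \<alpha>) = 1"
proof -
  obtain m n :: int where n: "n \<noteq> 0" and \<alpha>: "\<alpha> = 2 * pi * (of_int m / of_int n)"
    using assms unfolding rational_angle_def by blast
  obtain k where k: "nat \<bar>n\<bar> = Suc k"
    using n by (cases "nat \<bar>n\<bar>") auto
  have "real (Suc k) = of_int \<bar>n\<bar>"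
    by (simp flip: k)
  then have "real (Suc k) * \<alpha> = 2 * pi * of_int (sgn n * m)"
    using n by (simp add: \<alpha> sgn_if abs_if)
  then have "cos (real (Suc k) * \<alpha>) = 1"
    using cos_int_2pin by metis
  then show thesis
    by (rule that)
qed

lemma rational_angle_double_cos_int:
  assumes "rational_angle \<alpha>" and "cos \<alpha> \<in> \<rat>"
  shows "2 * cos \<alpha> \<in> \<int>"
proof -
  have "2 * cos \<alpha> \<in> \<rat>"
    using assms(2) by simp
  then obtain p q :: int where q: "q > 0" and cop: "coprime p q"
    and pq: "2 * cos \<alpha> = of_int p / of_int q"
    by (rule Rats_cases')
  obtain k where k: "cos (real (Suc k) * \<alpha>) = 1"
    using rational_angle_cos_multiple_eq_1[OF assms(1)] .
  have "of_int q * (2 * cos \<alpha>) = of_int p"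
    using q unfolding pq by simp
  from scaled_cos_multiple_cong[OF this, of k] obtain u where
    u: "real_of_int q ^ Suc k * 2 = of_int u" and dvd: "q dvd u - p ^ Suc k"
    unfolding k by auto
  have "real_of_int (q ^ Suc k * 2) = of_int u"
    using u by simp
  then have "u = q ^ Suc k * 2"
    by (simp only: of_int_eq_iff)
  then have "q dvd u"
    by simp
  then have "q dvd u - (u - p ^ Suc k)"
    using dvd by (rule dvd_diff)
  then have "q dvd p ^ Suc k"
    by simp
  moreover have "coprime (p ^ Suc k) q"
    using cop by (simp only: coprime_power_left_iff simp_thms)
  ultimately have "is_unit q"
    by (meson coprime_common_divisor dvd_refl)
  with q have "q = 1"
    by simp
  with pq show ?thesis
    by simp
qed

theorem mainTheorem1:
  fixes \<alpha> :: real
  assumes "rational_angle \<alpha>"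
    and "cos \<alpha> \<in> \<rat>"
  shows "cos \<alpha> \<in> {-1, -1/2, 0, 1/2, 1}"
proof -
  obtain c :: int where c: "2 * cos \<alpha> = of_int c"
    using rational_angle_double_cos_int[OF assms] by (rule Ints_cases)
  have "real_of_int (-2) \<le> of_int c" "real_of_int c \<le> of_int 2"
    using cos_ge_minus_one[of \<alpha>] cos_le_one[of \<alpha>] by (simp_all flip: c)
  then have "c \<in> {-2, -1, 0, 1, 2}"
    unfolding of_int_le_iff by auto
  with c show ?thesis
    by auto
qed

end
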